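(* Let $d\in\mathbb{N}$, let $G$ be a graph and $S\subseteq V(G)$ with $|S|=d$. For any integers $c_d,c_{d-1},\dots,c_2$ there exist a graph $G'$ containing $G$ as an induced subgraph, and values $c_1,c_0$, such that $\mathcal{E}(G';S,q)=\sum_{k=0}^{d}c_kq^k$.
   Context: Graphs are finite and simple; $N[X]$ is the closed neighborhood of $X$. Power domination process on a graph $H$ from $T\subseteq V(H)$: set $B:=N[T]$; then, while some $x\in B$ has exactly one vertex $y$ of $N[x]$ outside $B$, add $y$ to $B$. The final set is $\mathrm{Obs}(H;T)$ (with $\mathrm{Obs}(H;\emptyset)=\emptyset$). For $S\subseteq V(H)$ and $q\in[0,1]$, the expected value polynomial is $\mathcal{E}(H;S,q)=\sum_{W\subseteq S}|\mathrm{Obs}(H;W)|\,q^{|S\setminus W|}(1-q)^{|W|}$, the expected number of observed vertices when each sensor in $S$ fails independently with probability $q$ and the power domination process is run from the surviving sensors. *)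

theory Defs
  imports Complex_Main "Graph_Theory.Graph_Theory"
begin

text \<open>
  Finite simple graphs are \<^locale>\<open>pair_graph\<close>s: a finite vertex set together with a symmetric
  irreflexive arc relation.
\<close>

definition relabel :: "('a \<Rightarrow> 'b) \<Rightarrow> 'a pair_pre_digraph \<Rightarrow> 'b pair_pre_digraph" where
  "relabel f G = \<lparr> pverts = f ` pverts G, parcs = map_prod f f ` parcs G \<rparr>"

definition closed_nbhd :: "'a pair_pre_digraph \<Rightarrow> 'a set \<Rightarrow> 'a set" where
  "closed_nbhd H X = X \<union> parcs H `` X"

definition pd_step :: "'a pair_pre_digraph \<Rightarrow> 'a set \<Rightarrow> 'a set \<Rightarrow> bool" where
  "pd_step H B B' \<longleftrightarrow> (\<exists>x\<in>B. \<exists>y. closed_nbhd H {x} - B = {y} \<and> B' = insert y B)"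

definition pd_result :: "'a pair_pre_digraph \<Rightarrow> 'a set \<Rightarrow> 'a set \<Rightarrow> bool" where
  "pd_result H T B \<longleftrightarrow> (pd_step H)\<^sup>*\<^sup>* (closed_nbhd H T) B \<and> (\<nexists>B'. pd_step H B B')"

text \<open>
  The result does not depend on the order of the steps; see \<open>pd_result_Obs\<close> and
  \<open>pd_result_unique\<close> below.
\<close>

definition Obs :: "'a pair_pre_digraph \<Rightarrow> 'a set \<Rightarrow> 'a set" where
  "Obs H T = (THE B. pd_result H T B)"

definition expected_obs :: "'a pair_pre_digraph \<Rightarrow> 'a set \<Rightarrow> real \<Rightarrow> real" where
  "expected_obs H S q =
     (\<Sum>W\<in>Pow S. real (card (Obs H W)) * q ^ card (S - W) * (1 - q) ^ card W)"

lemma pd_steps_subset_closed: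
  assumes "(pd_step H)\<^sup>*\<^sup>* A B" and "A \<subseteq> C" and "\<nexists>C'. pd_step H C C'"
  shows "B \<subseteq> C"
  using assms(1)
proof (induction rule: rtranclp_induct)
  case base
  show ?case by (fact assms(2))
next
  case (step B B')
  then obtain x y where xy: "x \<in> B" "closed_nbhd H {x} - B = {y}" "B' = insert y B"
    unfolding pd_step_def by blast
  have "y \<in> C"
  proof (rule ccontr)
    assume "y \<notin> C"
    moreover have "closed_nbhd H {x} - C \<subseteq> {y}" using step.IH xy(2) by auto
    moreover have "y \<in> closed_nbhd H {x}" using xy(2) by auto
    ultimately have "closed_nbhd H {x} - C = {y}" by auto
    with xy(1) step.IH have "pd_step H C (insert y C)" unfolding pd_step_def by auto
    with assms(3) show False by blast
  qed
  with xy(3) step.IH show ?case by blast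
qed

lemma pd_result_unique:
  assumes "pd_result H T B" and "pd_result H T C"
  shows "B = C"
proof -
  have "closed_nbhd H T \<subseteq> D" if "pd_result H T D" for D
  proof -
    from that have "(pd_step H)\<^sup>*\<^sup>* (closed_nbhd H T) D" by (simp add: pd_result_def)
    then show ?thesis by (induction rule: rtranclp_induct) (auto simp: pd_step_def)
  qed
  note sub = this
  have "B \<subseteq> C"
    by (rule pd_steps_subset_closed[of H "closed_nbhd H T"])
      (use assms sub in \<open>simp_all add: pd_result_def\<close>)
  moreover have "C \<subseteq> B"
    by (rule pd_steps_subset_closed[of H "closed_nbhd H T"])
      (use assms sub in \<open>simp_all add: pd_result_def\<close>)
  ultimately show ?thesis by (rule subset_antisym)
qed

lemma pd_steps_terminate:
  assumes "pair_graph H" and "B \<subseteq> pverts H"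
  shows "\<exists>C. (pd_step H)\<^sup>*\<^sup>* B C \<and> (\<nexists>C'. pd_step H C C')"
  using assms(2)
proof (induction "card (pverts H - B)" arbitrary: B rule: less_induct)
  case less
  interpret pair_graph H by (fact assms(1))
  show ?case
  proof (cases "\<exists>B'. pd_step H B B'")
    case False
    then show ?thesis by blast
  next
    case True
    then obtain B' where B': "pd_step H B B'" by blast
    then obtain x y where xy: "x \<in> B" "closed_nbhd H {x} - B = {y}" "B' = insert y B"
      unfolding pd_step_def by blast
    have "y \<in> closed_nbhd H {x} - B" using xy(2) by simp
    with xy(1) have "(x, y) \<in> parcs H" and y: "y \<notin> B" by (auto simp: closed_nbhd_def)
    then have "y \<in> pverts H" by (intro in_arcsD2)
    note y = this y
    have "pverts H - B' \<subset> pverts H - B" using y xy(3) by blast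
    then have "card (pverts H - B') < card (pverts H - B)"
      by (intro psubset_card_mono) (simp_all add: pair_finite_verts)
    moreover have "B' \<subseteq> pverts H" using y xy(3) less.prems by blast
    ultimately obtain C where "(pd_step H)\<^sup>*\<^sup>* B' C" "\<nexists>C'. pd_step H C C'"
      using less.hyps by blast
    with converse_rtranclp_into_rtranclp[of "pd_step H", OF B'] show ?thesis by blast
  qed
qed

lemma pd_result_Obs:
  assumes "pair_graph H" and "T \<subseteq> pverts H"
  shows "pd_result H T (Obs H T)"
proof -
  interpret pair_graph H by (fact assms(1))
  have "closed_nbhd H T \<subseteq> pverts H"
    using assms(2) in_arcsD2 by (auto simp: closed_nbhd_def)
  from pd_steps_terminate[OF assms(1) this] obtain B where "pd_result H T B"
    unfolding pd_result_def by blast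
  then show ?thesis
    unfolding Obs_def by (rule theI) (rule pd_result_unique[OF _ \<open>pd_result H T B\<close>])
qed

lemma Obs_empty: "Obs H {} = {}"
proof -
  have "pd_result H {} {}"
    by (simp add: pd_result_def closed_nbhd_def pd_step_def)
  then show ?thesis
    unfolding Obs_def by (rule the_equality) (rule pd_result_unique[OF _ \<open>pd_result H {} {}\<close>])
qed

end

theory Submission
  imports Defs "HOL-Library.Nat_Bijection"
begin

text \<open>
  The expected value of the indicator of \<open>A \<inter> W \<noteq> {}\<close> is \<open>1 - q ^ card A\<close>. All of \<open>G\<close> is
  made inert, so that \<open>G\<close> itself contributes a fixed combination of such terms. A gadget for
  \<open>X, T \<subseteq> S\<close> with \<open>card X \<le> 1\<close> has a hub adjacent to \<open>T\<close>, a gate adjacent to the hub and to \<open>X\<close>,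
  and a tip pendant at the gate: \<open>T\<close> controls the hub, \<open>X\<close> the gate, and the gate forces the tip
  once the hub is observed as well. By inclusion--exclusion the gadget contributes
  \<open>3 - 2 * q ^ card T - 2 * q ^ card X + q ^ card (X \<union> T)\<close>. The leading coefficient is \<open>-1\<close> for
  \<open>X = {}\<close>, and \<open>1\<close> for \<open>X = {x}\<close>, \<open>x \<notin> T\<close>, so the coefficients can be
  corrected one after another from degree \<open>d\<close> down to degree \<open>2\<close>.

  Inertness: two blockers, adjacent to no vertex of \<open>S\<close> and hence never observed, are attached to
  all hubs and all vertices of \<open>G\<close> outside \<open>S\<close>; each \<open>s \<in> S\<close> is adjacent to two hubs with
  \<open>T = {s}\<close>, which stay unobserved when the sensor at \<open>s\<close> fails.
\<close>

section \<open>Probabilities of the sets of surviving sensors\<close>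

text \<open>The summands are the terms of the expanded product of \<open>(1 - q) + q\<close> over
  \<open>S\<close>.\<close>

lemma sum_Pow_binomial:
  fixes q :: "'b::comm_ring_1"
  assumes "finite S"
  shows "(\<Sum>W\<in>Pow S. q ^ card (S - W) * (1 - q) ^ card W) = 1"
proof -
  have "(\<Sum>W\<in>Pow S. (1 - q) ^ card W * q ^ card (S - W)) = (\<Prod>s\<in>S. (1 - q) + q)"
    using prod_add[OF assms, of "\<lambda>_. 1 - q" "\<lambda>_. q"] by simp
  then show ?thesis by (simp add: mult.commute)
qed

text \<open>Passing to the complement: \<open>W\<close> misses \<open>A\<close> iff every sensor of
  \<open>A\<close> fails, which splits off the factor \<open>q ^ card A\<close> and leaves the total
  weight over \<open>S - A\<close>, which is 1.\<close>

lemma sum_Pow_hit: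
  fixes q :: "'b::comm_ring_1"
  assumes "finite S" and "A \<subseteq> S"
  shows "(\<Sum>W\<in>Pow S. of_bool (A \<inter> W \<noteq> {}) * (q ^ card (S - W) * (1 - q) ^ card W))
    = 1 - q ^ card A"
proof -
  let ?w = "\<lambda>S W. q ^ card (S - W) * (1 - q) ^ card W"
  have w: "?w S W = q ^ card A * ?w (S - A) W" if "W \<subseteq> S - A" for W
  proof -
    have "S - W = A \<union> ((S - A) - W)" using that assms by blast
    moreover have "card (A \<union> ((S - A) - W)) = card A + card ((S - A) - W)"
      by (rule card_Un_disjoint) (use assms finite_subset in blast)+
    ultimately show ?thesis by (simp add: power_add)
  qed
  have "(\<Sum>W\<in>Pow S. of_bool (A \<inter> W = {}) * ?w S W) = (\<Sum>W\<in>Pow (S - A). ?w S W)"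
    by (rule sum.mono_neutral_cong_right) (use assms in auto)
  also have "\<dots> = (\<Sum>W\<in>Pow (S - A). q ^ card A * ?w (S - A) W)"
    by (rule sum.cong[OF refl]) (use w in blast)
  also have "\<dots> = q ^ card A"
    using sum_Pow_binomial[of "S - A" q] assms(1) by (simp flip: sum_distrib_left)
  finally have miss: "(\<Sum>W\<in>Pow S. of_bool (A \<inter> W = {}) * ?w S W) = q ^ card A" .
  have "(\<Sum>W\<in>Pow S. of_bool (A \<inter> W \<noteq> {}) * ?w S W) + (\<Sum>W\<in>Pow S. of_bool (A \<inter> W = {}) * ?w S W)
    = (\<Sum>W\<in>Pow S. ?w S W)"
    unfolding sum.distrib[symmetric] by (rule sum.cong) auto
  with miss show ?thesis
    using sum_Pow_binomial[OF assms(1), of q] by (simp add: eq_diff_eq)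
qed

(* The tag 1 is skipped because the simplifier would rewrite it to Suc 0. *)
abbreviation hub :: "nat \<Rightarrow> 'a + nat" where "hub i \<equiv> Inr (prod_encode (0, i))"
abbreviation gate :: "nat \<Rightarrow> 'a + nat" where "gate i \<equiv> Inr (prod_encode (2, i))"
abbreviation tip :: "nat \<Rightarrow> 'a + nat" where "tip i \<equiv> Inr (prod_encode (3, i))"
abbreviation blocker :: "nat \<Rightarrow> 'a + nat" where "blocker j \<equiv> Inr (prod_encode (4, j))"

section \<open>Construction of the extended graph\<close>

text \<open>An entry of \<open>gs\<close> is the pair \<open>(X, T)\<close> of a gadget; a list
  allows repeated gadgets.\<close>

locale gadget_extension = pair_graph G
  for G :: "'a pair_pre_digraph" +
  fixes S :: "'a set" and gs :: "('a set \<times> 'a set) list"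
  assumes S_verts: "S \<subseteq> pverts G"
    and gadget: "g \<in> set gs \<Longrightarrow> fst g \<subseteq> S \<and> snd g \<subseteq> S \<and> card (fst g) \<le> 1"
    and blocked: "s \<in> S \<Longrightarrow> \<exists>i j. i < length gs \<and> j < length gs \<and> i \<noteq> j \<and>
      snd (gs ! i) = {s} \<and> snd (gs ! j) = {s}"
begin

abbreviation "X i \<equiv> fst (gs ! i)"
abbreviation "T i \<equiv> snd (gs ! i)"

text \<open>Each new edge is listed in one direction only; \<open>ext\<close> symmetrizes.\<close>

inductive link :: "'a + nat \<Rightarrow> 'a + nat \<Rightarrow> bool" where
  old: "(v, w) \<in> parcs G \<Longrightarrow> link (Inl v) (Inl w)"
| hub_T: "i < length gs \<Longrightarrow> t \<in> T i \<Longrightarrow> link (hub i) (Inl t)"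
| hub_gate: "i < length gs \<Longrightarrow> link (hub i) (gate i)"
| gate_X: "i < length gs \<Longrightarrow> x \<in> X i \<Longrightarrow> link (gate i) (Inl x)"
| gate_tip: "i < length gs \<Longrightarrow> link (gate i) (tip i)"
| blocker_hub: "i < length gs \<Longrightarrow> j < 2 \<Longrightarrow> link (blocker j) (hub i)"
| blocker_old: "v \<in> pverts G - S \<Longrightarrow> j < 2 \<Longrightarrow> link (blocker j) (Inl v)"

definition ext :: "('a + nat) pair_pre_digraph" where
  "ext = \<lparr> pverts = Inl ` pverts G \<union> hub ` {..<length gs} \<union> gate ` {..<length gs}
      \<union> tip ` {..<length gs} \<union> blocker ` {..<2},
    parcs = {(x, y). link x y \<or> link y x} \<rparr>"

lemma finite_S: "finite S"
  using S_verts pair_finite_verts by (rule finite_subset)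

lemma X_sub: "i < length gs \<Longrightarrow> X i \<subseteq> S"
  and T_sub: "i < length gs \<Longrightarrow> T i \<subseteq> S"
  and X_card: "i < length gs \<Longrightarrow> card (X i) \<le> 1"
  using gadget[of "gs ! i"] by auto

lemma X_sub_sensors: "i < length gs \<Longrightarrow> X i \<inter> W \<noteq> {} \<Longrightarrow> X i \<subseteq> W"
  using X_card[of i] finite_subset[OF X_sub[of i] finite_S]
  by (auto simp: card_le_Suc0_iff_eq)

lemma link_verts:
  assumes "link x y"
  shows "x \<in> pverts ext \<and> y \<in> pverts ext \<and> x \<noteq> y"
  using assms
proof cases
  case (old v w)
  then show ?thesis using in_arcsD1 in_arcsD2 pair_no_loops[of "(v, v)"] by (auto simp: ext_def)
next
  case (hub_T i t)
  then have "t \<in> pverts G" using T_sub S_verts by blast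
  with hub_T show ?thesis by (auto simp: ext_def)
next
  case (gate_X i t)
  then have "t \<in> pverts G" using X_sub S_verts by blast
  with gate_X show ?thesis by (auto simp: ext_def)
qed (auto simp: ext_def)

lemma pair_graph_ext: "pair_graph ext"
proof
  have fin: "finite (pverts ext)" by (simp add: ext_def pair_finite_verts)
  have sub: "parcs ext \<subseteq> pverts ext \<times> pverts ext"
    using link_verts by (auto simp: ext_def)
  show "fst e \<in> pverts ext" "snd e \<in> pverts ext" if "e \<in> parcs ext" for e
    using that sub by auto
  show "finite (pverts ext)" by (fact fin)
  show "finite (parcs ext)" by (rule finite_subset[OF sub]) (use fin in simp)
  show "symmetric (with_proj ext)"
    by (auto simp: symmetric_def ext_def intro!: symI)
  show "fst e \<noteq> snd e" if "e \<in> parcs ext" for e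
    using that link_verts by (cases e) (auto simp: ext_def)
qed

lemma link_Inl_Inl: "link (Inl v) (Inl w) \<longleftrightarrow> (v, w) \<in> parcs G"
  by (auto elim: link.cases intro: link.intros)

text \<open>Only the rule \<open>old\<close> links two \<open>Inl\<close> vertices, so no edge is
  added inside \<open>G\<close>.\<close>

lemma induced_subgraph_ext: "induced_subgraph (with_proj (relabel Inl G)) (with_proj ext)"
proof -
  interpret ext: pair_graph ext by (rule pair_graph_ext)
  have relabel: "parcs (relabel Inl G) = {(Inl v, Inl w) | v w. (v, w) \<in> parcs G}"
    by (force simp: relabel_def)
  have arcs: "parcs (relabel Inl G)
    = {e \<in> parcs ext. fst e \<in> Inl ` pverts G \<and> snd e \<in> Inl ` pverts G}"
    unfolding relabel
    using in_arcsD1 in_arcsD2 arcs_symmetric by (auto simp: ext_def link_Inl_Inl)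
  have "wf_digraph (with_proj (relabel Inl G))"
    by unfold_locales (use in_arcsD1 in_arcsD2 in \<open>auto simp: relabel_def\<close>)
  with arcs show ?thesis
    by (auto simp: induced_subgraph_def subgraph_def compatible_def ext.wf_digraph)
      (auto simp: relabel_def ext_def)
qed

section \<open>The power domination process on the extended graph\<close>

text \<open>The expected outcome of the process: everything except the tips is already dominated by
  \<open>W\<close>, and only tips are reached by forcing.\<close>

definition observed :: "'a set \<Rightarrow> ('a + nat) set" where
  "observed W = Inl ` closed_nbhd G W \<union> hub ` {i. i < length gs \<and> T i \<inter> W \<noteq> {}}
    \<union> gate ` {i. i < length gs \<and> X i \<inter> W \<noteq> {}}
    \<union> tip ` {i. i < length gs \<and> X i \<inter> W \<noteq> {} \<and> T i \<inter> W \<noteq> {}}"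

lemma mem_observed:
  "Inl v \<in> observed W \<longleftrightarrow> v \<in> closed_nbhd G W"
  "hub i \<in> observed W \<longleftrightarrow> i < length gs \<and> T i \<inter> W \<noteq> {}"
  "gate i \<in> observed W \<longleftrightarrow> i < length gs \<and> X i \<inter> W \<noteq> {}"
  "tip i \<in> observed W \<longleftrightarrow> i < length gs \<and> X i \<inter> W \<noteq> {} \<and> T i \<inter> W \<noteq> {}"
  "blocker j \<notin> observed W"
  by (auto simp: observed_def)

lemma nbhd_ext: "y \<in> closed_nbhd ext A \<longleftrightarrow> y \<in> A \<or> (\<exists>x\<in>A. link x y \<or> link y x)"
  by (auto simp: closed_nbhd_def ext_def)

lemma nbhd_iff: "v \<in> closed_nbhd G A \<longleftrightarrow> v \<in> A \<or> (\<exists>w\<in>A. (v, w) \<in> parcs G \<or> (w, v) \<in> parcs G)"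
  unfolding closed_nbhd_def using arcs_symmetric by blast

lemma nbhd_sensors:
  assumes "W \<subseteq> S"
  shows "closed_nbhd ext (Inl ` W) = observed W - range tip"
proof (intro set_eqI iffI)
  fix y assume "y \<in> closed_nbhd ext (Inl ` W)"
  then show "y \<in> observed W - range tip"
    unfolding nbhd_ext using assms
    by (auto simp: mem_observed nbhd_iff elim!: link.cases)
next
  fix y assume "y \<in> observed W - range tip"
  then show "y \<in> closed_nbhd ext (Inl ` W)"
    unfolding nbhd_ext by (auto simp: observed_def closed_nbhd_def intro: link.intros)
qed

text \<open>Every observed vertex has either no unobserved neighbor or at least two. The pair is two
  hubs for a failed sensor, both blockers for a hub or a vertex of \<open>G\<close> outside
  \<open>S\<close>, and hub and tip for a gate whose \<open>T i\<close> misses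
  \<open>W\<close>.\<close>

lemma observed_closed:
  assumes W: "W \<subseteq> S"
  shows "\<nexists>B. pd_step ext (observed W) B"
proof
  assume "\<exists>B. pd_step ext (observed W) B"
  then obtain x y where x: "x \<in> observed W" and y: "closed_nbhd ext {x} - observed W = {y}"
    unfolding pd_step_def by blast
  have two: False if "link x a \<or> link a x" "link x b \<or> link b x" "a \<noteq> b"
    "a \<notin> observed W" "b \<notin> observed W" for a b
  proof -
    have "a \<in> closed_nbhd ext {x} - observed W" "b \<in> closed_nbhd ext {x} - observed W"
      using that by (auto simp: nbhd_ext)
    with y that(3) show False by simp
  qed
  have y': "link x y \<or> link y x" "y \<notin> observed W"
  proof -
    have "y \<in> closed_nbhd ext {x} - observed W" using y by simp
    then show "link x y \<or> link y x" "y \<notin> observed W" using x by (auto simp: nbhd_ext)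
  qed
  from x consider v where "x = Inl v" "v \<in> closed_nbhd G W"
    | i where "x = hub i" "i < length gs"
    | i where "x = gate i" "i < length gs" "X i \<inter> W \<noteq> {}"
    | i where "x = tip i" "i < length gs" "X i \<inter> W \<noteq> {}"
    unfolding observed_def by blast
  then show False
  proof cases
    case 1
    have v: "v \<in> pverts G"
      using 1(2) W S_verts in_arcsD2 by (auto simp: closed_nbhd_def)
    consider "v \<in> W" | "v \<in> S" "v \<notin> W" | "v \<notin> S" by blast
    then show False
    proof cases
      assume "v \<in> W"
      then have "y \<in> closed_nbhd ext (Inl ` W)" using y' 1 by (auto simp: nbhd_ext)
      with nbhd_sensors[OF W] y' show False by blast
    next
      assume "v \<in> S" "v \<notin> W"
      with blocked[of v] obtain i j where ij: "i < length gs" "j < length gs" "i \<noteq> j"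
        "T i = {v}" "T j = {v}" by blast
      show False
        by (rule two[of "hub i" "hub j"])
          (use ij 1 \<open>v \<notin> W\<close> in \<open>auto simp: mem_observed intro: link.intros\<close>)
    next
      assume "v \<notin> S"
      show False
        by (rule two[of "blocker 0" "blocker 1"])
          (use v 1 \<open>v \<notin> S\<close> in \<open>auto simp: mem_observed intro: link.intros\<close>)
    qed
  next
    case 2
    show False
      by (rule two[of "blocker 0" "blocker 1"])
        (use 2 in \<open>auto simp: mem_observed intro: link.intros\<close>)
  next
    case 3
    have "X i \<subseteq> W" using 3(2,3) by (rule X_sub_sensors)
    then have X_obs: "Inl x' \<in> observed W" if "x' \<in> X i" for x'
      using that by (auto simp: mem_observed closed_nbhd_def)
    \<comment> \<open>If \<open>T i\<close> met \<open>W\<close>, both candidates would be observed.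
      So it misses \<open>W\<close>, and then both are unobserved, contradicting that
      \<open>y\<close> is the only one.\<close>
    have "y = hub i \<or> y = tip i"
      using y' 3 X_obs by (auto elim!: link.cases)
    then have "T i \<inter> W = {}" using y'(2) 3 by (auto simp: mem_observed)
    show False
      by (rule two[of "hub i" "tip i"])
        (use 3 \<open>T i \<inter> W = {}\<close> in \<open>auto simp: mem_observed intro: link.intros\<close>)
  next
    case 4
    then have "y = gate i" using y' by (auto elim!: link.cases)
    with 4 y' show False by (auto simp: mem_observed)
  qed
qed

text \<open>The upper bound holds because \<open>observed W\<close> is stuck and contains the
  starting set. For the lower bound only the tips need a forcing step.\<close>

lemma Obs_ext:
  assumes W: "W \<subseteq> S"
  shows "Obs ext (Inl ` W) = observed W"
proof -
  have "Inl ` W \<subseteq> pverts ext" using W S_verts by (auto simp: ext_def)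
  from pd_result_Obs[OF pair_graph_ext this]
  have steps: "(pd_step ext)\<^sup>*\<^sup>* (closed_nbhd ext (Inl ` W)) (Obs ext (Inl ` W))"
    and final: "\<nexists>B. pd_step ext (Obs ext (Inl ` W)) B"
    by (simp_all add: pd_result_def)
  from steps have nbhd: "closed_nbhd ext (Inl ` W) \<subseteq> Obs ext (Inl ` W)"
    by (induction rule: rtranclp_induct) (auto simp: pd_step_def)
  have "observed W \<subseteq> Obs ext (Inl ` W)"
  proof
    fix y assume y: "y \<in> observed W"
    show "y \<in> Obs ext (Inl ` W)"
    proof (cases "y \<in> range tip")
      case False
      with y nbhd nbhd_sensors[OF W] show ?thesis by blast
    next
      case True
      then obtain i where i: "y = tip i" by blast
      with y have i': "i < length gs" "X i \<inter> W \<noteq> {}" "T i \<inter> W \<noteq> {}"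
        by (auto simp: mem_observed)
      have "X i \<subseteq> W" using i'(1,2) by (rule X_sub_sensors)
      \<comment> \<open>All three facts carry the premise on \<open>x\<close>; a suitable
        \<open>x\<close> exists by \<open>i'(2)\<close>.\<close>
      have obs: "gate i \<in> Obs ext (Inl ` W)" "hub i \<in> Obs ext (Inl ` W)"
        "Inl x \<in> Obs ext (Inl ` W)" if "x \<in> X i" for x
      proof -
        have "{gate i, hub i, Inl x} \<subseteq> observed W - range tip"
          using i' that \<open>X i \<subseteq> W\<close> by (auto simp: mem_observed closed_nbhd_def)
        with nbhd nbhd_sensors[OF W]
        show "gate i \<in> Obs ext (Inl ` W)" "hub i \<in> Obs ext (Inl ` W)"
          "Inl x \<in> Obs ext (Inl ` W)" by blast+
      qed
      have "closed_nbhd ext {gate i} - Obs ext (Inl ` W) \<subseteq> {tip i}"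
        using obs i' by (auto simp: nbhd_ext elim!: link.cases)
      moreover have "tip i \<in> closed_nbhd ext {gate i}"
        using i' by (auto simp: nbhd_ext intro: link.intros)
      \<comment> \<open>Otherwise the tip would be the only unobserved neighbor of the gate, and one
        more step would be possible.\<close>
      ultimately have "tip i \<in> Obs ext (Inl ` W)"
        using final obs i'(2) unfolding pd_step_def by blast
      with i show ?thesis by simp
    qed
  qed
  moreover have "Obs ext (Inl ` W) \<subseteq> observed W"
    by (rule pd_steps_subset_closed[OF steps _ observed_closed[OF W]])
      (use nbhd_sensors[OF W] in blast)
  ultimately show ?thesis by blast
qed


section \<open>Counting observed vertices and taking expectations\<close>

text \<open>By symmetry of adjacency, \<open>v\<close> is dominated iff a surviving sensor lies in
  its closed neighborhood. Intersecting with \<open>S\<close> gives a set to which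
  \<open>sum_Pow_hit\<close> applies.\<close>

lemma card_nbhd:
  assumes W: "W \<subseteq> S"
  shows "card (closed_nbhd G W) = (\<Sum>v\<in>pverts G. of_bool (S \<inter> closed_nbhd G {v} \<inter> W \<noteq> {}))"
proof -
  have "v \<in> closed_nbhd G W \<longleftrightarrow> v \<in> pverts G \<and> S \<inter> closed_nbhd G {v} \<inter> W \<noteq> {}" for v
    using W S_verts in_arcsD1 in_arcsD2 unfolding nbhd_iff disjoint_iff Int_iff by blast
  then have "closed_nbhd G W = {v \<in> pverts G. S \<inter> closed_nbhd G {v} \<inter> W \<noteq> {}}"
    by blast
  then show ?thesis by (simp add: pair_finite_verts Int_def)
qed

text \<open>The indicator of a tip is a product; replacing it by inclusion--exclusion produces the
  factors 2 and the negative union term.\<close>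

lemma card_observed:
  assumes W: "W \<subseteq> S"
  shows "real (card (observed W)) =
    (\<Sum>v\<in>pverts G. of_bool (S \<inter> closed_nbhd G {v} \<inter> W \<noteq> {})) +
    (\<Sum>i<length gs. 2 * of_bool (T i \<inter> W \<noteq> {}) + 2 * of_bool (X i \<inter> W \<noteq> {})
      - of_bool ((X i \<union> T i) \<inter> W \<noteq> {}))"
proof -
  let ?H = "{i. i < length gs \<and> T i \<inter> W \<noteq> {}}" and ?K = "{i. i < length gs \<and> X i \<inter> W \<noteq> {}}"
    and ?L = "{i. i < length gs \<and> X i \<inter> W \<noteq> {} \<and> T i \<inter> W \<noteq> {}}"
  have card_eq: "real (card {i. i < length gs \<and> P i}) = (\<Sum>i<length gs. of_bool (P i))" for P
    by (simp add: Int_def)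
  have "finite (closed_nbhd G W)"
    by (rule finite_subset[OF _ pair_finite_verts])
      (use W S_verts in_arcsD2 in \<open>auto simp: closed_nbhd_def\<close>)
  \<comment> \<open>The shared right-hand side \<open>E\<close> fixes the type of the polymorphic
    images.\<close>
  moreover have "Inl ` A \<inter> hub ` B = E" "Inl ` A \<inter> gate ` B = E" "Inl ` A \<inter> tip ` B = E"
    "hub ` B \<inter> gate ` C = E" "hub ` B \<inter> tip ` C = E" "gate ` B \<inter> tip ` C = E"
    if "E = {}" for A :: "'a set" and B C and E :: "('a + nat) set"
    using that by auto
  ultimately have "card (observed W) = card (Inl ` closed_nbhd G W :: ('a + nat) set) + card (hub ` ?H :: ('a + nat) set) + card (gate ` ?K :: ('a + nat) set)
      + card (tip ` ?L :: ('a + nat) set)"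
    unfolding observed_def by (simp add: card_Un_disjoint Int_Un_distrib2)
  also have "\<dots> = card (closed_nbhd G W) + card ?H + card ?K + card ?L"
    by (simp add: card_image inj_on_def)
  finally have "real (card (observed W)) = real (card (closed_nbhd G W))
    + (\<Sum>i<length gs. of_bool (T i \<inter> W \<noteq> {}) + of_bool (X i \<inter> W \<noteq> {})
      + of_bool (X i \<inter> W \<noteq> {} \<and> T i \<inter> W \<noteq> {}))"
    by (simp add: card_eq sum.distrib)
  also have "(\<Sum>i<length gs. of_bool (T i \<inter> W \<noteq> {}) + of_bool (X i \<inter> W \<noteq> {})
      + of_bool (X i \<inter> W \<noteq> {} \<and> T i \<inter> W \<noteq> {}) :: real)
    = (\<Sum>i<length gs. 2 * of_bool (T i \<inter> W \<noteq> {}) + 2 * of_bool (X i \<inter> W \<noteq> {})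
      - of_bool ((X i \<union> T i) \<inter> W \<noteq> {}))"
    by (rule sum.cong) (auto simp: Int_Un_distrib2)
  finally show ?thesis by (simp add: card_nbhd[OF W])
qed

text \<open>Linearity of expectation: after exchanging the sums, \<open>sum_Pow_hit\<close>
  evaluates each indicator.\<close>

lemma expected_obs_ext:
  "expected_obs ext (Inl ` S) q =
    (\<Sum>v\<in>pverts G. 1 - q ^ card (S \<inter> closed_nbhd G {v})) +
    (\<Sum>i<length gs. 3 - 2 * q ^ card (T i) - 2 * q ^ card (X i) + q ^ card (X i \<union> T i))"
proof -
  let ?w = "\<lambda>W. q ^ card (S - W) * (1 - q) ^ card W"
  let ?hit = "\<lambda>A W. of_bool (A \<inter> W \<noteq> {}) :: real"
  have inj: "inj (Inl :: 'a \<Rightarrow> 'a + nat)" by simp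
  have "expected_obs ext (Inl ` S) q
    = (\<Sum>W\<in>Pow S. real (card (Obs ext (Inl ` W))) * q ^ card (Inl ` S - Inl ` W :: ('a + nat) set)
        * (1 - q) ^ card (Inl ` W :: ('a + nat) set))"
    unfolding expected_obs_def image_Pow_surj[OF refl, symmetric]
    by (subst sum.reindex) (simp_all add: inj_on_image_Pow)
  also have "\<dots> = (\<Sum>W\<in>Pow S. real (card (observed W)) * ?w W)"
    by (rule sum.cong[OF refl])
      (auto simp: Obs_ext card_image inj image_set_diff[OF inj, symmetric])
  also have "\<dots> = (\<Sum>W\<in>Pow S. (\<Sum>v\<in>pverts G. ?hit (S \<inter> closed_nbhd G {v}) W * ?w W)
    + (\<Sum>i<length gs. 2 * (?hit (T i) W * ?w W) + 2 * (?hit (X i) W * ?w W)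
      - ?hit (X i \<union> T i) W * ?w W))"
    by (rule sum.cong[OF refl])
      (simp only: Pow_iff card_observed sum_distrib_right distrib_right left_diff_distrib mult.assoc)
  also have "\<dots> = (\<Sum>v\<in>pverts G. \<Sum>W\<in>Pow S. ?hit (S \<inter> closed_nbhd G {v}) W * ?w W)
    + (\<Sum>i<length gs. 2 * (\<Sum>W\<in>Pow S. ?hit (T i) W * ?w W)
      + 2 * (\<Sum>W\<in>Pow S. ?hit (X i) W * ?w W) - (\<Sum>W\<in>Pow S. ?hit (X i \<union> T i) W * ?w W))"
    unfolding sum.distrib sum_subtractf sum_distrib_left
    by (simp only: sum.swap[of _ "Pow S"])
  also have "\<dots> = (\<Sum>v\<in>pverts G. 1 - q ^ card (S \<inter> closed_nbhd G {v})) +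
    (\<Sum>i<length gs. 2 * (1 - q ^ card (T i)) + 2 * (1 - q ^ card (X i))
      - (1 - q ^ card (X i \<union> T i)))"
    by (intro arg_cong2[of _ _ _ _ "(+)"] arg_cong2[of _ _ _ _ "(-)"] arg_cong2[of _ _ _ _ "(*)"]
        sum.cong refl sum_Pow_hit)
      (use finite_S X_sub T_sub in auto)
  finally show ?thesis by (simp add: algebra_simps)
qed

end

section \<open>Prescribing the coefficients of degree at least 2\<close>

text \<open>This is the coefficient of \<open>q ^ k\<close> in the summand of one gadget in
  \<open>expected_obs_ext\<close>.\<close>

definition gadget_coeff :: "'a set \<times> 'a set \<Rightarrow> nat \<Rightarrow> int" where
  "gadget_coeff g k = 3 * of_bool (k = 0) - 2 * of_bool (k = card (snd g))
    - 2 * of_bool (k = card (fst g)) + of_bool (k = card (fst g \<union> snd g))"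

text \<open>The top degree is settled first. Its gadgets disturb only lower degrees, and the
  induction hypothesis, applied to the corrected targets, repairs these.\<close>

lemma gadgets_exist:
  fixes h :: "nat \<Rightarrow> int"
  assumes "finite S" and "m \<le> card S"
  shows "\<exists>gs. (\<forall>g\<in>set gs. fst g \<subseteq> S \<and> snd g \<subseteq> S \<and> card (fst g) \<le> 1) \<and>
    (\<forall>k\<ge>2. (\<Sum>g\<leftarrow>gs. gadget_coeff g k) = (if k \<le> m then h k else 0))"
  using assms(2)
proof (induction m arbitrary: h)
  case 0
  show ?case by (rule exI[of _ "[]"]) simp
next
  case (Suc m)
  show ?case
  proof (cases "m = 0")
    case True
    \<comment> \<open>Here the top degree is 1, so no degree is prescribed.\<close>
    then show ?thesis by (intro exI[of _ "[]"]) simp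
  next
    case False
    obtain U where U: "U \<subseteq> S" "card U = Suc m"
      using Suc.prems obtain_subset_with_card_n by metis
    then obtain x T where xT: "U = insert x T" "x \<notin> T" "card T = m"
      by (auto simp: card_Suc_eq)
    \<comment> \<open>The sign of the target selects leading coefficient -1 or 1. The latter needs
      \<open>m > 0\<close>, so that \<open>{x}\<close> has size below \<open>Suc m\<close>.\<close>
    define g where "g = (if h (Suc m) \<le> 0 then ({}, U) else ({x}, T))"
    define gs where "gs = replicate (nat \<bar>h (Suc m)\<bar>) g"
    have g: "fst g \<subseteq> S" "snd g \<subseteq> S" "card (fst g) \<le> 1"
      using U xT by (auto simp: g_def)
    have coeff: "(\<Sum>g\<leftarrow>gs. gadget_coeff g k) = (if k = Suc m then h k else 0)"
      if "k \<ge> 2" "k > m" for k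
      using that U xT False
      by (auto simp: gs_def g_def sum_list_replicate gadget_coeff_def)
    obtain gs' where gs': "\<forall>g\<in>set gs'. fst g \<subseteq> S \<and> snd g \<subseteq> S \<and> card (fst g) \<le> 1"
      "\<And>k. k \<ge> 2 \<Longrightarrow> (\<Sum>g\<leftarrow>gs'. gadget_coeff g k)
        = (if k \<le> m then h k - (\<Sum>g\<leftarrow>gs. gadget_coeff g k) else 0)"
      using Suc.IH[of "\<lambda>k. h k - (\<Sum>g\<leftarrow>gs. gadget_coeff g k)"] Suc.prems by auto
    show ?thesis
    proof (intro exI[of _ "gs @ gs'"] conjI allI impI)
      show "\<forall>g\<in>set (gs @ gs'). fst g \<subseteq> S \<and> snd g \<subseteq> S \<and> card (fst g) \<le> 1"
        using gs'(1) g by (auto simp: gs_def)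
      show "(\<Sum>g\<leftarrow>gs @ gs'. gadget_coeff g k) = (if k \<le> Suc m then h k else 0)"
        if "k \<ge> 2" for k
        using gs'(2)[OF that] coeff[OF that] by (auto simp: le_Suc_eq)
    qed
  qed
qed

section \<open>Assembling the extension with the prescribed polynomial\<close>

theorem theorem2p7:
  fixes G :: "'a pair_pre_digraph" and S :: "'a set" and d :: nat and c :: "nat \<Rightarrow> int"
  assumes "pair_graph G" and "S \<subseteq> pverts G" and "card S = d"
  shows "\<exists>(G' :: ('a + nat) pair_pre_digraph) (c1 :: int) (c0 :: int).
           pair_graph G' \<and>
           induced_subgraph (with_proj (relabel Inl G)) (with_proj G') \<and>
           (\<forall>q\<in>{0..1}. expected_obs G' (Inl ` S) q =
              (\<Sum>k=0..d. real_of_int ((c(1 := c1, 0 := c0)) k) * q ^ k))"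
proof -
  interpret G: pair_graph G by (fact assms(1))
  have fin: "finite S" using assms(2) G.pair_finite_verts by (rule finite_subset)
  then obtain ss where ss: "set ss = S" using finite_list by blast
  let ?a = "\<lambda>v. card (S \<inter> closed_nbhd G {v})"
  define singles where "singles = map (\<lambda>s. ({} :: 'a set, {s})) ss"
  \<comment> \<open>The contribution of \<open>G\<close> and of two copies of
    \<open>singles\<close>, the copies being there to satisfy \<open>blocked\<close>. The gadgets
    \<open>gs\<close> only have to supply the difference to \<open>c\<close>.\<close>
  define base where "base k = (\<Sum>v\<in>pverts G. of_bool (k = 0) - of_bool (k = ?a v))
    + 2 * (\<Sum>g\<leftarrow>singles. gadget_coeff g k)" for k
  obtain gs where gs: "\<forall>g\<in>set gs. fst g \<subseteq> S \<and> snd g \<subseteq> S \<and> card (fst g) \<le> 1"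
    "\<And>k. k \<ge> 2 \<Longrightarrow> (\<Sum>g\<leftarrow>gs. gadget_coeff g k) = (if k \<le> d then c k - base k else 0)"
    using gadgets_exist[OF fin order_refl, of "\<lambda>k. c k - base k"] assms(3) by blast
  define all where "all = singles @ singles @ gs"
  define C where "C k = (\<Sum>v\<in>pverts G. of_bool (k = 0) - of_bool (k = ?a v))
    + (\<Sum>g\<leftarrow>all. gadget_coeff g k)" for k
  interpret E: gadget_extension G S all
  proof
    show "S \<subseteq> pverts G" by (fact assms(2))
    show "fst g \<subseteq> S \<and> snd g \<subseteq> S \<and> card (fst g) \<le> 1" if "g \<in> set all" for g
      using that gs(1) ss by (auto simp: all_def singles_def)
    show "\<exists>i j. i < length all \<and> j < length all \<and> i \<noteq> j \<and> snd (all ! i) = {s} \<and> snd (all ! j) = {s}"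
      if "s \<in> S" for s
    proof -
      from that ss obtain i where i: "i < length ss" "ss ! i = s" by (auto simp: in_set_conv_nth)
      show ?thesis
        \<comment> \<open>The same position in the first and in the second copy of
          \<open>singles\<close>.\<close>
        by (rule exI[of _ i], rule exI[of _ "length ss + i"])
          (use i in \<open>auto simp: all_def singles_def nth_append\<close>)
    qed
  qed
  \<comment> \<open>All exponents that occur are sizes of subsets of \<open>S\<close>, hence at most
    \<open>d\<close>, so cutting the sum off at \<open>d\<close> loses nothing.\<close>
  have monom: "(\<Sum>k=0..d. of_bool (k = a) * q ^ k) = q ^ a" if "a \<le> d" for a and q :: real
    using that by (simp add: of_bool_def if_distrib[of "\<lambda>x. x * _"] cong: if_cong)
  have le: "card A \<le> d" if "A \<subseteq> S" for A
    using that fin assms(3) card_mono by blast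
  have expected: "expected_obs E.ext (Inl ` S) q = (\<Sum>k=0..d. real_of_int (C k) * q ^ k)" for q
  proof -
    let ?m = "\<lambda>a. \<Sum>k=0..d. of_bool (k = a) * q ^ k"
    have C: "real_of_int (C k) * q ^ k
      = (\<Sum>v\<in>pverts G. of_bool (k = 0) * q ^ k - of_bool (k = ?a v) * q ^ k)
      + (\<Sum>i<length all. 3 * (of_bool (k = 0) * q ^ k) - 2 * (of_bool (k = card (E.T i)) * q ^ k)
        - 2 * (of_bool (k = card (E.X i)) * q ^ k) + of_bool (k = card (E.X i \<union> E.T i)) * q ^ k)" for k
      by (simp add: C_def gadget_coeff_def sum_list_sum_nth atLeast0LessThan sum_distrib_right
          ring_distribs mult.assoc)
    have "(\<Sum>k=0..d. real_of_int (C k) * q ^ k) = (\<Sum>v\<in>pverts G. ?m 0 - ?m (?a v))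
      + (\<Sum>i<length all. 3 * ?m 0 - 2 * ?m (card (E.T i)) - 2 * ?m (card (E.X i))
        + ?m (card (E.X i \<union> E.T i)))"
      unfolding C sum.distrib sum_subtractf sum_distrib_left
      by (simp only: sum.swap[of _ "{0..d}"])
    also have "\<dots> = expected_obs E.ext (Inl ` S) q"
      unfolding E.expected_obs_ext
      by (intro arg_cong2[of _ _ _ _ "(+)"] sum.cong refl)
        (simp_all add: monom le E.X_sub E.T_sub)
    finally show ?thesis by simp
  qed
  \<comment> \<open>Degrees 0 and 1 agree by the choice of the free values, higher ones by the
    choice of \<open>gs\<close>.\<close>
  have coeff: "C k = (c(1 := C 1, 0 := C 0)) k" if "k \<le> d" for k
    using that gs(2)[of k] by (auto simp: C_def base_def all_def)
  have "expected_obs E.ext (Inl ` S) q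
    = (\<Sum>k=0..d. real_of_int ((c(1 := C 1, 0 := C 0)) k) * q ^ k)" for q
    unfolding expected
    by (intro sum.cong refl arg_cong2[of _ _ _ _ "(*)"] arg_cong[of _ _ real_of_int] coeff) simp
  then show ?thesis
    by (intro exI[of _ E.ext] exI[of _ "C 1"] exI[of _ "C 0"] conjI ballI
        E.pair_graph_ext E.induced_subgraph_ext)
qed

end
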